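(* Let $n,k\ge 1$ and let $\xi_1,\ldots,\xi_n$ be a spreadable sequence of random variables with values in $[k]$. Suppose that the sequence is invariant under permutations of the alphabet, i.e. $(\tau(\xi_1),\ldots,\tau(\xi_n))\stackrel{d}{=}(\xi_1,\ldots,\xi_n)$ for every $\tau\in\mathfrak S_k$, and that the law of the random measure $\beta=\sum_{j=1}^n\delta_{\xi_j}$ is ergodic under the induced action of $\mathfrak S_k$, i.e. it is concentrated on a single orbit of the action $\sum_{j}\delta_{x_j}\mapsto\sum_j\delta_{\tau(x_j)}$, $\tau\in\mathfrak S_k$. Then $\xi_1,\ldots,\xi_n$ is exchangeable.
   Context: $[k]=\{1,\dots,k\}$ and $\mathfrak S_k$ is the group of permutations of $[k]$. A random sequence $\xi_1,\dots,\xi_n$ is spreadable if deleting the $j$th coordinate gives a sequence of length $n-1$ whose joint distribution is the same for every $j=1,\dots,n$ (equivalently, all $(n-1)$-dimensional marginal distributions, with coordinates kept in increasing order of index, are identical). It is exchangeable if its joint distribution is invariant under all permutations of the indices $1,\dots,n$. *)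

theory Defs
  imports "HOL-Probability.Probability" "HOL-Combinatorics.Permutations"
begin

definition joint_law :: "'a measure \<Rightarrow> 'b measure \<Rightarrow> nat \<Rightarrow> (nat \<Rightarrow> 'a \<Rightarrow> 'b) \<Rightarrow> (nat \<Rightarrow> 'b) measure"
  where "joint_law M S m X =
    distr M (PiM {1..m} (\<lambda>_. S)) (\<lambda>\<omega>. \<lambda>i\<in>{1..m}. X i \<omega>)"

text \<open>Reindexing by \<^term>\<open>skip j\<close> deletes the coordinate \<open>j\<close> and keeps the remaining
  ones in increasing order.\<close>
definition skip :: "nat \<Rightarrow> nat \<Rightarrow> nat"
  where "skip j i = (if i < j then i else Suc i)"

definition spreadable :: "'a measure \<Rightarrow> 'b measure \<Rightarrow> nat \<Rightarrow> (nat \<Rightarrow> 'a \<Rightarrow> 'b) \<Rightarrow> bool"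
  where "spreadable M S n X \<longleftrightarrow>
    (\<forall>j\<in>{1..n}. \<forall>j'\<in>{1..n}.
      joint_law M S (n - 1) (\<lambda>i. X (skip j i)) = joint_law M S (n - 1) (\<lambda>i. X (skip j' i)))"

definition exchangeable :: "'a measure \<Rightarrow> 'b measure \<Rightarrow> nat \<Rightarrow> (nat \<Rightarrow> 'a \<Rightarrow> 'b) \<Rightarrow> bool"
  where "exchangeable M S n X \<longleftrightarrow>
    (\<forall>\<pi>. \<pi> permutes {1..n} \<longrightarrow> joint_law M S n (\<lambda>i. X (\<pi> i)) = joint_law M S n X)"

definition alphabet :: "nat \<Rightarrow> nat measure"
  where "alphabet k = count_space {1..k}"

definition alphabet_invariant :: "'a measure \<Rightarrow> nat \<Rightarrow> nat \<Rightarrow> (nat \<Rightarrow> 'a \<Rightarrow> nat) \<Rightarrow> bool"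
  where "alphabet_invariant M k n X \<longleftrightarrow>
    (\<forall>\<tau>. \<tau> permutes {1..k} \<longrightarrow>
      joint_law M (alphabet k) n (\<lambda>i \<omega>. \<tau> (X i \<omega>)) = joint_law M (alphabet k) n X)"

text \<open>The measure \<open>\<Sum>\<^sub>j \<delta>\<^bsub>x j\<^esub>\<close> on \<open>S\<close>; the library's Dirac measure is \<^const>\<open>return\<close>.\<close>
definition sum_dirac :: "'b measure \<Rightarrow> nat \<Rightarrow> (nat \<Rightarrow> 'b) \<Rightarrow> 'b measure"
  where "sum_dirac S n x =
    measure_of (space S) (sets S) (\<lambda>A. \<Sum>j\<in>{1..n}. emeasure (return S (x j)) A)"

lemma space_sum_dirac [simp]: "space (sum_dirac S n x) = space S"
  by (simp add: sum_dirac_def)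

lemma sets_sum_dirac [simp]: "sets (sum_dirac S n x) = sets S"
  by (simp add: sum_dirac_def)

lemma emeasure_sum_dirac:
  assumes "A \<in> sets S"
  shows "emeasure (sum_dirac S n x) A = (\<Sum>j\<in>{1..n}. indicator A (x j))"
proof -
  have "emeasure (sum_dirac S n x) A = (\<Sum>j\<in>{1..n}. emeasure (return S (x j)) A)"
  proof (rule emeasure_measure_of[OF sum_dirac_def])
    show "sets S \<subseteq> Pow (space S)" by (rule sets.space_closed)
    show "A \<in> sets (sum_dirac S n x)" using assms by simp
    show "positive (sets (sum_dirac S n x)) (\<lambda>A. \<Sum>j\<in>{1..n}. emeasure (return S (x j)) A)"
      by (simp add: positive_def)
    show "countably_additive (sets (sum_dirac S n x)) (\<lambda>A. \<Sum>j\<in>{1..n}. emeasure (return S (x j)) A)"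
    proof (rule countably_additiveI)
      fix F :: "nat \<Rightarrow> 'a set"
      assume "range F \<subseteq> sets (sum_dirac S n x)" "disjoint_family F"
      then have "(\<Sum>i. emeasure (return S (x j)) (F i)) = emeasure (return S (x j)) (\<Union>i. F i)" for j
        by (intro suminf_emeasure) auto
      then show "(\<Sum>i. \<Sum>j\<in>{1..n}. emeasure (return S (x j)) (F i)) =
          (\<Sum>j\<in>{1..n}. emeasure (return S (x j)) (\<Union>i. F i))"
        by (subst suminf_sum) auto
    qed
  qed
  then show ?thesis using assms by simp
qed

definition point_measures :: "nat \<Rightarrow> nat \<Rightarrow> nat measure set"
  where "point_measures n k = {sum_dirac (alphabet k) n x | x. x \<in> {1..n} \<rightarrow> {1..k}}"

definition relabel :: "nat \<Rightarrow> (nat \<Rightarrow> nat) \<Rightarrow> nat measure \<Rightarrow> nat measure"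
  where "relabel k \<tau> \<mu> = distr \<mu> (alphabet k) \<tau>"

lemma relabel_sum_dirac:
  assumes "\<tau> permutes {1..k}" and x: "x \<in> {1..n} \<rightarrow> {1..k}"
  shows "relabel k \<tau> (sum_dirac (alphabet k) n x) = sum_dirac (alphabet k) n (\<lambda>j. \<tau> (x j))"
proof (rule measure_eqI)
  fix A assume "A \<in> sets (relabel k \<tau> (sum_dirac (alphabet k) n x))"
  then have A: "A \<subseteq> {1..k}" by (simp add: relabel_def alphabet_def)
  have "\<tau> \<in> measurable (alphabet k) (alphabet k)"
    using permutes_in_image[OF assms(1)] unfolding alphabet_def by (simp add: Pi_iff)
  then have m: "\<tau> \<in> measurable (sum_dirac (alphabet k) n x) (alphabet k)"
    by (simp cong: measurable_cong_sets)
  have "emeasure (relabel k \<tau> (sum_dirac (alphabet k) n x)) A =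
      (\<Sum>j\<in>{1..n}. indicator (\<tau> -` A \<inter> {1..k}) (x j))"
    unfolding relabel_def using A
    by (subst emeasure_distr[OF m]) (auto simp: alphabet_def emeasure_sum_dirac)
  also have "\<dots> = (\<Sum>j\<in>{1..n}. indicator A (\<tau> (x j)))"
    using x by (intro sum.cong) (auto simp: indicator_def Pi_iff)
  also have "\<dots> = emeasure (sum_dirac (alphabet k) n (\<lambda>j. \<tau> (x j))) A"
    using A by (simp add: emeasure_sum_dirac alphabet_def)
  finally show "emeasure (relabel k \<tau> (sum_dirac (alphabet k) n x)) A =
    emeasure (sum_dirac (alphabet k) n (\<lambda>j. \<tau> (x j))) A" .
qed (simp add: relabel_def)

definition relabel_orbit :: "nat \<Rightarrow> nat measure \<Rightarrow> nat measure set"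
  where "relabel_orbit k \<mu> = {relabel k \<tau> \<mu> | \<tau>. \<tau> permutes {1..k}}"

text \<open>The random measure takes values in the finite set \<^term>\<open>point_measures n k\<close>, on which
  the sigma-algebra generated by the evaluations \<open>\<mu> \<mapsto> \<mu> A\<close> is the discrete one.\<close>
definition random_measure_law :: "'a measure \<Rightarrow> nat \<Rightarrow> nat \<Rightarrow> (nat \<Rightarrow> 'a \<Rightarrow> nat) \<Rightarrow> nat measure measure"
  where "random_measure_law M k n X =
    distr M (count_space (point_measures n k)) (\<lambda>\<omega>. sum_dirac (alphabet k) n (\<lambda>j. X j \<omega>))"

lemma measurable_sum_dirac:
  assumes X: "\<And>j. j \<in> {1..n} \<Longrightarrow> X j \<in> measurable M (alphabet k)"
  shows "(\<lambda>\<omega>. sum_dirac (alphabet k) n (\<lambda>j. X j \<omega>))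
    \<in> measurable M (count_space (point_measures n k))"
proof -
  define f where "f x = sum_dirac (alphabet k) n x" for x
  have eq: "sum_dirac (alphabet k) n (\<lambda>j. X j \<omega>) = f (\<lambda>j\<in>{1..n}. X j \<omega>)" for \<omega>
    unfolding f_def sum_dirac_def
    by (intro arg_cong[where f = "measure_of _ _"] ext sum.cong) auto
  have "(\<lambda>\<omega>. \<lambda>j\<in>{1..n}. X j \<omega>) \<in> measurable M (PiM {1..n} (\<lambda>_. alphabet k))"
    using X by (intro measurable_restrict) auto
  also have "PiM {1..n} (\<lambda>_. alphabet k) = count_space ({1..n} \<rightarrow>\<^sub>E {1..k})"
    unfolding alphabet_def by (rule count_space_PiM_finite) auto
  finally have "(\<lambda>\<omega>. \<lambda>j\<in>{1..n}. X j \<omega>) \<in> measurable M (count_space ({1..n} \<rightarrow>\<^sub>E {1..k}))" .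
  moreover have "f \<in> measurable (count_space ({1..n} \<rightarrow>\<^sub>E {1..k})) (count_space (point_measures n k))"
    by (auto simp: f_def point_measures_def PiE_def)
  ultimately have "(\<lambda>\<omega>. f (\<lambda>j\<in>{1..n}. X j \<omega>)) \<in> measurable M (count_space (point_measures n k))"
    by (rule measurable_compose)
  then show ?thesis by (simp add: eq)
qed

text \<open>Ergodicity in the sense of being carried by a single orbit.\<close>
definition ergodic_law :: "nat \<Rightarrow> nat \<Rightarrow> nat measure measure \<Rightarrow> bool"
  where "ergodic_law k n L \<longleftrightarrow> (\<exists>\<mu>\<in>point_measures n k. AE \<nu> in L. \<nu> \<in> relabel_orbit k \<mu>)"

end

theory Submission
  imports Defs
begin

text \<open>Let \<open>p\<close> be the law of the word \<open>\<xi>\<^sub>1 \<dots> \<xi>\<^sub>n\<close>. By induction on \<open>v\<close>, the letters occurring fewer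
  than \<open>v\<close> times can be moved freely within a word without changing \<open>p\<close>. For the step, delete an
  occurrence of a letter \<open>a\<close> of multiplicity \<open>v\<close>. Ergodicity fixes the sum of the squared
  multiplicities, so only the letters of multiplicity \<open>v - 1\<close> in the remaining word can have been
  deleted. By the induction hypothesis all of these may be placed next to the remaining
  occurrences of \<open>a\<close>, after which alphabet invariance makes them all contribute equally to the
  marginal. Spreadability then says that the position of the deleted \<open>a\<close> is irrelevant.\<close>

section \<open>Rearranging words by adjacent swaps\<close>

text \<open>The letters of \<open>x'\<close> are brought one at a time to the front of the unmatched
  part, with \<open>u\<close> the part already matched. Every swap on the way involves a letter of
  \<open>L\<close>: a letter outside \<open>L\<close> that is due next is the first such letter of
  the unmatched part, so it only passes letters of \<open>L\<close>.\<close>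

lemma adjacent_swaps_reorder:
  assumes swap: "\<And>u a b w. mset (u @ a # b # w) = m \<Longrightarrow> a \<in> L \<Longrightarrow> p (u @ a # b # w) = p (u @ b # a # w)"
    and "mset (u @ x) = m" "mset x = mset x'" "filter (\<lambda>c. c \<notin> L) x = filter (\<lambda>c. c \<notin> L) x'"
  shows "p (u @ x) = p (u @ x')"
  using assms(2-)
proof (induction x' arbitrary: u x)
  case Nil
  then show ?case by simp
next
  case (Cons c xs)
  have bring_front: "p (u @ s @ c # t) = p (u @ c # s @ t)"
    if "mset (u @ s @ c # t) = m" "c \<in> L \<or> set s \<subseteq> L" for s t
    using that
  proof (induction s arbitrary: t rule: rev_induct)
    case (snoc d s)
    have "p (u @ (s @ [d]) @ c # t) = p (u @ s @ c # d # t)"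
    proof (cases "c \<in> L")
      case True
      then show ?thesis using swap[of "u @ s" c d t] snoc.prems by (simp add: ac_simps add_mset_commute)
    next
      case False
      then show ?thesis using swap[of "u @ s" d c t] snoc.prems by simp
    qed
    also have "\<dots> = p (u @ c # s @ d # t)"
      using snoc.prems by (intro snoc.IH) (auto simp: ac_simps)
    finally show ?case by simp
  qed simp
  obtain s t where x: "x = s @ c # t" and st: "c \<in> L \<or> set s \<subseteq> L"
  proof (cases "c \<in> L")
    case True
    have "c \<in> set x" using Cons.prems(2) by (metis list.set_intros(1) mset_eq_setD)
    then obtain s t where "x = s @ c # t" by (meson split_list)
    with True that show ?thesis by blast
  next
    case False
    then have "filter (\<lambda>c. c \<notin> L) x = c # filter (\<lambda>c. c \<notin> L) xs" using Cons.prems(3) by simp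
    then obtain s t where "x = s @ c # t" "\<forall>d\<in>set s. d \<in> L" by (auto simp: filter_eq_Cons_iff)
    with that show ?thesis by blast
  qed
  have "filter (\<lambda>c. c \<notin> L) (s @ t) = filter (\<lambda>c. c \<notin> L) xs"
    using Cons.prems(3) st unfolding x
    by (cases "c \<in> L") (auto simp: filter_empty_conv subset_iff filter_False)
  then have "p ((u @ [c]) @ (s @ t)) = p ((u @ [c]) @ xs)"
    using Cons.prems(1,2) unfolding x by (intro Cons.IH) (auto simp: ac_simps)
  then show ?case using bring_front[of s t] Cons.prems(1) st x by simp
qed

section \<open>Letter counts and clustered words\<close>

text \<open>Since (q+1)^2 = q^2 + 2q + 1, the sum of squares after inserting \<open>c\<close> into
  \<open>N\<close> determines \<open>count N c\<close>. Once that sum is prescribed, this tells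
  which letters can have been deleted from a word.\<close>

lemma sum_count_squares_add_mset:
  assumes "finite A" "c \<in> A"
  shows "(\<Sum>d\<in>A. (count (add_mset c N) d)\<^sup>2) = (\<Sum>d\<in>A. (count N d)\<^sup>2) + 2 * count N c + 1"
proof -
  have "(\<Sum>d\<in>A. (count (add_mset c N) d)\<^sup>2)
      = (\<Sum>d\<in>A. (count N d)\<^sup>2 + (if d = c then 2 * count N c + 1 else 0))"
    by (intro sum.cong) (auto simp: power2_eq_square)
  also have "\<dots> = (\<Sum>d\<in>A. (count N d)\<^sup>2) + 2 * count N c + 1"
    using assms by (simp add: sum.distrib)
  finally show ?thesis .
qed

text \<open>If \<open>bs\<close> is distinct, avoids \<open>a\<close>, and its letters are as
  frequent in \<open>y\<close> as \<open>a\<close>, this is a rearrangement of \<open>y\<close> made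
  of blocks \<open>a # bs\<close> and other letters; exchanging \<open>a\<close> with a letter of
  \<open>bs\<close> then only reorders inside the blocks. As a letterwise substitution it respects
  concatenation, so a place of insertion in \<open>y\<close> carries over.\<close>

definition cluster :: "'b \<Rightarrow> 'b list \<Rightarrow> 'b list \<Rightarrow> 'b list"
  where "cluster a bs y =
    concat (map (\<lambda>c. if c = a then a # bs else if c \<in> set bs then [] else [c]) y)"

lemma cluster_append: "cluster a bs (s @ t) = cluster a bs s @ cluster a bs t"
  by (simp add: cluster_def)

lemma count_cluster:
  assumes "distinct bs" "a \<notin> set bs"
  shows "count (mset (cluster a bs y)) c = count (mset y) (if c \<in> set bs then a else c)"
  using assms by (induction y) (auto simp: cluster_def distinct_count_atmost_1)

lemma filter_cluster:
  assumes "\<And>c. c \<in> set bs \<Longrightarrow> \<not> P c"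
  shows "filter P (cluster a bs y) = filter P y"
  using assms by (induction y) (auto simp: cluster_def filter_empty_conv)

text \<open>The transposition turns each block \<open>a # bs\<close> into one that starts with
  \<open>c\<close> and has \<open>a\<close> in the former place of \<open>c\<close>. The filter
  keeps only this \<open>a\<close> of the block, and the letters outside the blocks are
  fixed.\<close>

lemma filter_transpose_cluster:
  assumes P: "\<And>c. c \<in> set bs \<Longrightarrow> \<not> P c" and bs: "distinct bs" "a \<notin> set bs" "c \<in> set bs" and "P a"
  shows "filter P (map (Transposition.transpose a c) (cluster a bs y)) = filter P y"
proof -
  obtain s t where st: "bs = s @ c # t" using bs(3) by (meson split_list)
  have "map (Transposition.transpose a c) s = s" "map (Transposition.transpose a c) t = t"
    using bs st by (auto intro!: map_idI simp: Transposition.transpose_def)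
  moreover have "filter P s = []" "filter P t = []" using P st by (auto simp: filter_empty_conv)
  ultimately have "filter P (map (Transposition.transpose a c) bs) = [a]" using \<open>P a\<close> st by simp
  moreover have "Transposition.transpose a c d = d" if "d \<notin> set bs" "d \<noteq> a" for d
    using that bs(3) by (auto simp: Transposition.transpose_def)
  ultimately have single: "filter P (map (Transposition.transpose a c) (cluster a bs [d])) = filter P [d]" for d
    using bs(3) P \<open>P a\<close> by (auto simp: cluster_def)
  then show ?thesis
  proof (induction y)
    case Nil
    show ?case by (simp add: cluster_def)
  next
    case (Cons d y)
    then show ?case
      using cluster_append[of a bs "[d]" y] single[of d]
      by (cases "P d") (simp_all del: filter.simps add: filter.simps(2)[of P d y])
  qed
qed

lemma count_image_mset_transpose:
  "count (image_mset (Transposition.transpose a c) N) d = count N (Transposition.transpose a c d)"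
  by (induction N) (auto simp: Transposition.transpose_def)

section \<open>Permutation invariance of weights on words\<close>

text \<open>Probability enters only through \<open>p\<close>: \<open>spread\<close> expresses
  equality of marginals as insertion into one shorter word at two places, and \<open>supp\<close>
  records the sum of squares fixed by ergodicity.\<close>

lemma spread_law_permutation_invariant:
  fixes p :: "'b list \<Rightarrow> real"
  assumes "finite A"
    and spread: "\<And>s t s' t'. s @ t = s' @ t' \<Longrightarrow> (\<Sum>c\<in>A. p (s @ c # t)) = (\<Sum>c\<in>A. p (s' @ c # t'))"
    and sym: "\<And>\<tau> x. \<tau> permutes A \<Longrightarrow> p (map \<tau> x) = p x"
    and supp: "\<And>x. p x \<noteq> 0 \<Longrightarrow> set x \<subseteq> A \<and> (\<Sum>c\<in>A. (count (mset x) c)\<^sup>2) = C"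
    and "mset x = mset x'"
  shows "p x = p x'"
proof -
  \<comment> \<open>Only letters with at least \<open>v\<close> occurrences must keep their relative
    order. For \<open>v = 0\<close> this forces \<open>x = x'\<close>.\<close>
  have "p x = p x'" if "mset x = mset x'"
    "filter (\<lambda>c. v \<le> count (mset x) c) x = filter (\<lambda>c. v \<le> count (mset x) c) x'" for v x x'
    using that
  proof (induction v arbitrary: x x')
    case 0
    then show ?case by simp
  next
    case (Suc v)
    define m where "m = mset x"
    show ?case
    \<comment> \<open>The condition in \<open>supp\<close> depends on the multiset alone, so where
      it fails both sides vanish.\<close>
    proof (cases "set x \<subseteq> A \<and> (\<Sum>c\<in>A. (count m c)\<^sup>2) = C")
      case False
      then show ?thesis using supp[of x] supp[of x'] Suc.prems(1) mset_eq_setD unfolding m_def by metis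
    next
      case good: True
      have swap: "p (u @ a # b # w) = p (u @ b # a # w)"
        if m: "mset (u @ a # b # w) = m" and a: "a \<in> {c. count m c < Suc v}" for u a b w
      proof (cases "count m a < v")
        case True
        \<comment> \<open>The filter for \<open>v\<close> drops \<open>a\<close>, so the swap leaves
          the filtered word unchanged.\<close>
        then show ?thesis using m by (intro Suc.IH) (auto simp: ac_simps)
      next
        case False
        with a have va: "count m a = v" by simp
        have "finite {c \<in> A. c \<noteq> a \<and> Suc (count m c) = v}" using \<open>finite A\<close> by simp
        \<comment> \<open>Deleting one \<open>a\<close> leaves \<open>v - 1\<close> copies of it, so
          these are the other letters that are then as frequent as \<open>a\<close>. For
          \<open>v = 1\<close> they are the letters of \<open>A\<close> absent from the
          word.\<close>
        then obtain bs where bs: "set bs = {c \<in> A. c \<noteq> a \<and> Suc (count m c) = v}" "distinct bs"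
          using finite_distinct_list by metis
        define B where "B = insert a (set bs)"
        have mA: "set_mset m = set x" unfolding m_def by simp
        have "a \<in> set_mset m" unfolding m[symmetric] by simp
        then have "B \<subseteq> A" and abs: "a \<notin> set bs" using good mA bs by (auto simp: B_def)
        define P where "P c \<longleftrightarrow> v \<le> count m c" for c
        have Pbs: "\<not> P c" if "c \<in> set bs" for c using that bs by (auto simp: P_def)
        have Pa: "P a" using va by (simp add: P_def)
        \<comment> \<open>Clustering the remainder makes the letters that can have been deleted,
          those of \<open>B\<close>, interchangeable, so the marginal is a multiple of a single
          value of \<open>p\<close>.\<close>
        have collapse: "(\<Sum>c\<in>A. p (cluster a bs s @ c # cluster a bs t)) = real (card B) * p (s @ a # t)"
          if st: "mset (s @ a # t) = m" for s t
        proof -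
          define N where "N = mset (s @ t)"
          have mN: "m = add_mset a N" using st by (simp add: N_def)
          \<comment> \<open>In \<open>N\<close> the letters of \<open>B\<close> all have
            \<open>v - 1\<close> occurrences, so clustering only rearranges it.\<close>
          have N: "mset (cluster a bs s @ cluster a bs t) = N"
          proof (rule multiset_eqI)
            fix c show "count (mset (cluster a bs s @ cluster a bs t)) c = count N c"
              using bs va mN
              by (auto simp: cluster_append[symmetric] count_cluster abs N_def[symmetric]
                  simp del: mset_append)
          qed
          have IH: "p z = p (s @ a # t)" if "mset z = m" "filter P z = filter P (s @ a # t)" for z
            using that st by (intro Suc.IH) (auto simp: P_def[abs_def])
          have "p (cluster a bs s @ c # cluster a bs t) = (if c \<in> B then p (s @ a # t) else 0)"
            if "c \<in> A" for c
          proof (cases "c \<in> set bs")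
            case True
            \<comment> \<open>Exchanging \<open>a\<close> and \<open>c\<close> makes the inserted
              letter an \<open>a\<close> and preserves \<open>N\<close>, where both are equally
              frequent; \<open>IH\<close> then undoes the clustering.\<close>
            define \<tau> where "\<tau> = Transposition.transpose a c"
            have "\<tau> permutes A" unfolding \<tau>_def using \<open>B \<subseteq> A\<close> \<open>c \<in> A\<close>
              by (intro permutes_swap_id) (auto simp: B_def)
            then have "p (cluster a bs s @ c # cluster a bs t)
                = p (map \<tau> (cluster a bs s @ c # cluster a bs t))"
              by (rule sym[symmetric])
            also have "\<dots> = p (map \<tau> (cluster a bs s) @ a # map \<tau> (cluster a bs t))"
              by (simp add: \<tau>_def)
            also have "\<dots> = p (s @ a # t)"
            proof (rule IH)
              have "Suc (count m c) = v" "c \<noteq> a" using True bs(1) abs by auto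
              then have "count N a = count N c" using va by (simp add: mN)
              then have "image_mset \<tau> N = N"
                by (intro multiset_eqI) (simp add: \<tau>_def count_image_mset_transpose Transposition.transpose_def)
              then show "mset (map \<tau> (cluster a bs s) @ a # map \<tau> (cluster a bs t)) = m"
                using N[symmetric] mN by simp
              show "filter P (map \<tau> (cluster a bs s) @ a # map \<tau> (cluster a bs t)) = filter P (s @ a # t)"
                using filter_transpose_cluster[of bs P a c] Pbs bs(2) abs True Pa by (simp add: \<tau>_def)
            qed
            finally show ?thesis using True by (simp add: B_def)
          next
            case c: False
            show ?thesis
            proof (cases "c = a")
              case True
              then show ?thesis using N mN Pbs by (auto simp: B_def filter_cluster intro!: IH)
            next
              case False
              \<comment> \<open>A nonzero value would make the sums of squares with \<open>c\<close>
                and with \<open>a\<close> inserted agree, hence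
                \<open>count N c = count N a\<close>, and \<open>c\<close> would lie in
                \<open>bs\<close>.\<close>
              have "p (cluster a bs s @ c # cluster a bs t) = 0"
              proof (rule ccontr)
                assume "p (cluster a bs s @ c # cluster a bs t) \<noteq> 0"
                moreover have "mset (cluster a bs s @ c # cluster a bs t) = add_mset c N"
                  using N[symmetric] by simp
                ultimately have "(\<Sum>d\<in>A. (count (add_mset c N) d)\<^sup>2) = C"
                  using supp by metis
                also have "C = (\<Sum>d\<in>A. (count (add_mset a N) d)\<^sup>2)" using good mN by simp
                finally have "count N c = count N a"
                  using sum_count_squares_add_mset[OF \<open>finite A\<close>] \<open>c \<in> A\<close> \<open>B \<subseteq> A\<close>
                  by (simp add: B_def)
                then show False using c False \<open>c \<in> A\<close> bs va mN by auto
              qed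
              then show ?thesis using False c by (simp add: B_def)
            qed
          qed
          then have "(\<Sum>c\<in>A. p (cluster a bs s @ c # cluster a bs t))
              = (\<Sum>c\<in>A. if c \<in> B then p (s @ a # t) else 0)"
            by (intro sum.cong) auto
          also have "\<dots> = real (card B) * p (s @ a # t)"
            using \<open>finite A\<close> \<open>B \<subseteq> A\<close> by (simp add: sum.If_cases Int_absorb1)
          finally show ?thesis .
        qed
        have "real (card B) * p (u @ a # b # w)
            = (\<Sum>c\<in>A. p (cluster a bs u @ c # cluster a bs (b # w)))"
          using m by (rule collapse[symmetric])
        \<comment> \<open>Both splittings come from the same clustered word; the place of insertion
          passes the whole image of \<open>b\<close>, which may be empty or a block.\<close>
        also have "\<dots> = (\<Sum>c\<in>A. p (cluster a bs (u @ [b]) @ c # cluster a bs w))"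
          by (rule spread) (simp add: cluster_append[symmetric])
        also have "\<dots> = real (card B) * p ((u @ [b]) @ a # w)"
          using m by (intro collapse) (simp add: add_mset_commute)
        finally have "real (card B) * p (u @ a # b # w) = real (card B) * p ((u @ [b]) @ a # w)" .
        moreover have "card B \<noteq> 0" by (simp add: B_def)
        ultimately show ?thesis by simp
      qed
      have "p ([] @ x) = p ([] @ x')"
        by (rule adjacent_swaps_reorder[where L = "{c. count m c < Suc v}" and m = m and p = p, OF swap])
          (use Suc.prems in \<open>auto simp: m_def not_less\<close>)
      then show ?thesis by simp
    qed
  qed
  \<comment> \<open>This \<open>v\<close> exceeds every multiplicity, so both filtered words are
    empty.\<close>
  from this[of x x' "Suc (size (mset x))"] assms(5) show ?thesis
    by (metis (no_types, lifting) count_le_size filter_False not_less_eq_eq)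
qed

section \<open>Word probabilities and joint laws\<close>

text \<open>With lists, inserting a letter is written \<open>s @ c # t\<close>. The bound
  \<open>Suc m\<close> is exclusive, and words of length other than \<open>m\<close> get probability
  0.\<close>

definition word_prob :: "'a measure \<Rightarrow> nat \<Rightarrow> (nat \<Rightarrow> 'a \<Rightarrow> 'b) \<Rightarrow> 'b list \<Rightarrow> real"
  where "word_prob M m X x = measure M {\<omega> \<in> space M. map (\<lambda>i. X i \<omega>) [1..<Suc m] = x}"

lemma PiM_alphabet: "PiM {1..m::nat} (\<lambda>_. alphabet k) = count_space ({1..m} \<rightarrow>\<^sub>E {1..k})"
  unfolding alphabet_def by (rule count_space_PiM_finite) auto

lemma measurable_word:
  fixes X :: "nat \<Rightarrow> 'a \<Rightarrow> nat"
  assumes "\<And>j. j \<in> {1..m} \<Longrightarrow> X j \<in> measurable M (alphabet k)"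
  shows "(\<lambda>\<omega>. \<lambda>i\<in>{1..m}. X i \<omega>) \<in> measurable M (count_space ({1..m} \<rightarrow>\<^sub>E {1..k}))"
  using assms unfolding PiM_alphabet[symmetric] by (intro measurable_restrict) auto

lemma map_word_eq_iff: "map f [1..<Suc m] = map g [1..<Suc m] \<longleftrightarrow> (\<forall>i\<in>{1..m}. f i = g i)"
  by (auto simp: atLeastLessThanSuc_atLeastAtMost simp del: upt_Suc)

lemma word_event_vimage:
  assumes X: "\<And>j. j \<in> {1..m} \<Longrightarrow> X j \<in> measurable M (alphabet k)"
  shows "{\<omega> \<in> space M. map (\<lambda>i. X i \<omega>) [1..<Suc m] = x}
      = (\<lambda>\<omega>. \<lambda>i\<in>{1..m}. X i \<omega>) -` {f \<in> {1..m} \<rightarrow>\<^sub>E {1..k}. map f [1..<Suc m] = x} \<inter> space M"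
proof -
  have "map (\<lambda>i\<in>{1..m}. X i \<omega>) [1..<Suc m] = map (\<lambda>i. X i \<omega>) [1..<Suc m]" for \<omega>
    unfolding map_word_eq_iff by simp
  moreover have "(\<lambda>i\<in>{1..m}. X i \<omega>) \<in> {1..m} \<rightarrow>\<^sub>E {1..k}" if "\<omega> \<in> space M" for \<omega>
    using measurable_space[OF measurable_word[of m X M k, OF X] that] by simp
  ultimately show ?thesis by (auto simp del: upt_Suc)
qed

lemma word_event_sets:
  assumes "\<And>j. j \<in> {1..m} \<Longrightarrow> X j \<in> measurable M (alphabet k)"
  shows "{\<omega> \<in> space M. map (\<lambda>i. X i \<omega>) [1..<Suc m] = x} \<in> sets M"
proof -
  have "{\<omega> \<in> space M. map (\<lambda>i. X i \<omega>) [1..<Suc m] = x}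
      = (\<lambda>\<omega>. \<lambda>i\<in>{1..m}. X i \<omega>) -` {f \<in> {1..m} \<rightarrow>\<^sub>E {1..k}. map f [1..<Suc m] = x} \<inter> space M"
    using assms by (rule word_event_vimage)
  also have "\<dots> \<in> sets M" by (intro measurable_sets[OF measurable_word[of m X M k, OF assms]]) auto
  finally show ?thesis .
qed

text \<open>This transfers the equalities of joint laws in spreadability and alphabet invariance to
  word probabilities.\<close>

lemma word_prob_joint_law:
  assumes "\<And>j. j \<in> {1..m} \<Longrightarrow> X j \<in> measurable M (alphabet k)"
  shows "word_prob M m X x
    = measure (joint_law M (alphabet k) m X) {f \<in> {1..m} \<rightarrow>\<^sub>E {1..k}. map f [1..<Suc m] = x}"
proof -
  have "{\<omega> \<in> space M. map (\<lambda>i. X i \<omega>) [1..<Suc m] = x}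
      = (\<lambda>\<omega>. \<lambda>i\<in>{1..m}. X i \<omega>) -` {f \<in> {1..m} \<rightarrow>\<^sub>E {1..k}. map f [1..<Suc m] = x} \<inter> space M"
    using assms by (rule word_event_vimage)
  then show ?thesis
    unfolding word_prob_def joint_law_def PiM_alphabet
    by (subst measure_distr[OF measurable_word[of m X M k, OF assms]]) auto
qed

text \<open>The joint law lives on a finite discrete space, where singletons decide, and a word
  determines its function in \<open>{1..m} \<rightarrow>\<^sub>E {1..k}\<close> uniquely.\<close>

lemma joint_law_eqI:
  assumes "prob_space M"
    and X: "\<And>j. j \<in> {1..m} \<Longrightarrow> X j \<in> measurable M (alphabet k)"
    and Y: "\<And>j. j \<in> {1..m} \<Longrightarrow> Y j \<in> measurable M (alphabet k)"
    and eq: "\<And>f. word_prob M m X (map f [1..<Suc m]) = word_prob M m Y (map f [1..<Suc m])"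
  shows "joint_law M (alphabet k) m X = joint_law M (alphabet k) m Y"
proof -
  interpret prob_space M by fact
  have single: "emeasure (joint_law M (alphabet k) m Z) {f}
      = ennreal (word_prob M m Z (map f [1..<Suc m]))"
    if Z: "\<And>j. j \<in> {1..m} \<Longrightarrow> Z j \<in> measurable M (alphabet k)" and f: "f \<in> {1..m} \<rightarrow>\<^sub>E {1..k}" for Z f
  proof -
    have "{g \<in> {1..m} \<rightarrow>\<^sub>E {1..k}. map g [1..<Suc m] = map f [1..<Suc m]} = {f}"
      unfolding map_word_eq_iff using f PiE_ext by blast
    moreover have "prob_space (joint_law M (alphabet k) m Z)"
      unfolding joint_law_def PiM_alphabet by (intro prob_space_distr measurable_word Z)
    then have "finite_measure (joint_law M (alphabet k) m Z)" by (rule prob_space.finite_measure)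
    ultimately show ?thesis
      using word_prob_joint_law[of m Z M k, OF Z]
      by (simp add: finite_measure.emeasure_eq_measure del: upt_Suc)
  qed
  show ?thesis
  proof (rule measure_eqI_finite)
    show "finite ({1..m} \<rightarrow>\<^sub>E {1..k})" by (intro finite_PiE) auto
    fix f assume "f \<in> {1..m} \<rightarrow>\<^sub>E {1..k}"
    then show "emeasure (joint_law M (alphabet k) m X) {f} = emeasure (joint_law M (alphabet k) m Y) {f}"
      using single[of X f] single[of Y f] X Y eq by metis
  qed (simp_all add: joint_law_def PiM_alphabet[simplified])
qed

text \<open>The event that the remaining word is \<open>s @ t\<close> splits according to the
  deleted letter \<open>c\<close>. As \<open>s\<close> fills the positions up to
  \<open>length s\<close>, the deleted position is \<open>Suc (length s)\<close>.\<close>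

lemma word_prob_skip:
  assumes "prob_space M"
    and X: "\<And>j. j \<in> {1..n} \<Longrightarrow> X j \<in> measurable M (alphabet k)"
    and n: "Suc (length s + length t) = n"
  shows "word_prob M (n - 1) (\<lambda>i. X (skip (Suc (length s)) i)) (s @ t)
    = (\<Sum>c\<in>{1..k}. word_prob M n X (s @ c # t))"
proof -
  interpret prob_space M by fact
  define j where "j = Suc (length s)"
  have split: "[1..<Suc n] = [1..<j] @ j # [Suc j..<Suc n]"
    using n upt_add_eq_append[of 1 j "Suc n - j"] upt_conv_Cons[of j "Suc n"] by (simp add: j_def del: upt_Suc)
  have split': "[1..<n] = [1..<j] @ [j..<n]"
    using n upt_add_eq_append[of 1 j "n - j"] by (simp add: j_def del: upt_Suc)
  \<comment> \<open>From \<open>j\<close> on, \<open>skip j\<close> is the successor, so the tail is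
    read at the indices after \<open>j\<close>.\<close>
  have "map (\<lambda>i. X (skip j i) \<omega>) [j..<n] = map (\<lambda>i. X i \<omega>) (map Suc [j..<n])" for \<omega>
    by (simp add: skip_def del: map_Suc_upt)
  then have word: "map (\<lambda>i. X (skip j i) \<omega>) [1..<n]
      = map (\<lambda>i. X i \<omega>) [1..<j] @ map (\<lambda>i. X i \<omega>) [Suc j..<Suc n]" for \<omega>
    unfolding split' map_append map_Suc_upt by (auto simp: skip_def)
  have "{\<omega> \<in> space M. map (\<lambda>i. X (skip j i) \<omega>) [1..<n] = s @ t}
      = (\<Union>c\<in>{1..k}. {\<omega> \<in> space M. map (\<lambda>i. X i \<omega>) [1..<Suc n] = s @ c # t})"
    using measurable_space[OF X[of j]] n
    unfolding word split by (auto simp: j_def append_eq_append_conv alphabet_def simp del: upt_Suc)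
  moreover have "disjoint_family_on (\<lambda>c. {\<omega> \<in> space M. map (\<lambda>i. X i \<omega>) [1..<Suc n] = s @ c # t}) {1..k}"
    by (auto simp: disjoint_family_on_def simp del: upt_Suc)
  ultimately show ?thesis
    using n finite_measure_finite_Union[of "{1..k}"
        "\<lambda>c. {\<omega> \<in> space M. map (\<lambda>i. X i \<omega>) [1..<Suc n] = s @ c # t}"]
      word_event_sets[of n X M k, OF X]
    by (auto simp: word_prob_def j_def[symmetric] image_subset_iff simp del: upt_Suc)
qed

section \<open>Letter multiplicities along an orbit\<close>

lemma count_word: "count (mset (map f [1..<Suc n])) c = card {j \<in> {1..n}. f j = c}"
proof -
  have "count (mset (map f [1..<Suc n])) c = length (filter (\<lambda>j. f j = c) [1..<Suc n])"
    by (induction n) simp_all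
  also have "\<dots> = card (set (filter (\<lambda>j. f j = c) [1..<Suc n]))"
    by (rule distinct_card[symmetric]) simp
  also have "set (filter (\<lambda>j. f j = c) [1..<Suc n]) = {j \<in> {1..n}. f j = c}" by auto
  finally show ?thesis .
qed

lemma emeasure_sum_dirac_singleton:
  assumes "c \<in> {1..k}"
  shows "emeasure (sum_dirac (alphabet k) n f) {c} = of_nat (card {j \<in> {1..n}. f j = c})"
proof -
  have "(\<Sum>j\<in>{1..n}. indicator {c} (f j)) = (\<Sum>j\<in>{j \<in> {1..n}. f j = c}. (1::ennreal))"
    by (intro sum.mono_neutral_cong_right) (auto simp: indicator_def)
  then show ?thesis using assms by (simp add: emeasure_sum_dirac alphabet_def)
qed

text \<open>Relabelling only permutes the multiplicities of the letters, so a symmetric function of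
  them, such as the sum of squares, is constant on an orbit.\<close>

lemma sum_count_squares_relabel_orbit:
  assumes "x \<in> {1..n} \<rightarrow> {1..k}"
    and "sum_dirac (alphabet k) n f \<in> relabel_orbit k (sum_dirac (alphabet k) n x)"
  shows "(\<Sum>c\<in>{1..k}. (count (mset (map f [1..<Suc n])) c)\<^sup>2)
    = (\<Sum>c\<in>{1..k}. (card {j \<in> {1..n}. x j = c})\<^sup>2)"
proof -
  obtain \<tau> where \<tau>: "\<tau> permutes {1..k}"
    and eq: "sum_dirac (alphabet k) n f = sum_dirac (alphabet k) n (\<lambda>j. \<tau> (x j))"
    using assms relabel_sum_dirac by (auto simp: relabel_orbit_def)
  have "card {j \<in> {1..n}. f j = \<tau> c} = card {j \<in> {1..n}. x j = c}" if "c \<in> {1..k}" for c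
  proof -
    have "\<tau> c \<in> {1..k}" using \<tau> that permutes_in_image by metis
    \<comment> \<open>Both counts are the mass of the point \<open>\<tau> c\<close> under the same
      measure.\<close>
    then have "card {j \<in> {1..n}. f j = \<tau> c} = card {j \<in> {1..n}. \<tau> (x j) = \<tau> c}"
      using emeasure_sum_dirac_singleton[of "\<tau> c" k n f]
        emeasure_sum_dirac_singleton[of "\<tau> c" k n "\<lambda>j. \<tau> (x j)"] eq by simp
    then show ?thesis using permutes_inj[OF \<tau>] by (simp add: inj_eq)
  qed
  then have "(\<Sum>c\<in>{1..k}. (card {j \<in> {1..n}. f j = \<tau> c})\<^sup>2)
      = (\<Sum>c\<in>{1..k}. (card {j \<in> {1..n}. x j = c})\<^sup>2)"
    by simp
  then show ?thesis unfolding count_word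
    using sum.permute[OF \<tau>, of "\<lambda>c. (card {j \<in> {1..n}. f j = c})\<^sup>2"] by (simp add: o_def)
qed

section \<open>From spreadability to exchangeability\<close>

theorem corollary1:
  fixes M :: "'a measure" and \<xi> :: "nat \<Rightarrow> 'a \<Rightarrow> nat" and n k :: nat
  assumes "n \<ge> 1" and "k \<ge> 1"
    and "prob_space M"
    and "\<And>j. j \<in> {1..n} \<Longrightarrow> \<xi> j \<in> measurable M (alphabet k)"
    and "spreadable M (alphabet k) n \<xi>"
    and "alphabet_invariant M k n \<xi>"
    and "ergodic_law k n (random_measure_law M k n \<xi>)"
  shows "exchangeable M (alphabet k) n \<xi>"
proof -
  interpret prob_space M by fact
  note meas = assms(4)
  define p where "p = word_prob M n \<xi>"
  obtain x0 where x0: "x0 \<in> {1..n} \<rightarrow> {1..k}"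
    and \<mu>: "AE \<nu> in random_measure_law M k n \<xi>. \<nu> \<in> relabel_orbit k (sum_dirac (alphabet k) n x0)"
    using assms(7) by (auto simp: ergodic_law_def point_measures_def)
  have orbit: "AE \<omega> in M. sum_dirac (alphabet k) n (\<lambda>j. \<xi> j \<omega>)
      \<in> relabel_orbit k (sum_dirac (alphabet k) n x0)"
    using AE_distrD[OF measurable_sum_dirac[of n \<xi> M k, OF meas]] \<mu>
    unfolding random_measure_law_def by blast
  define C where "C = (\<Sum>c\<in>{1..k}. (card {j \<in> {1..n}. x0 j = c})\<^sup>2)"
  \<comment> \<open>An event of nonzero probability is not contained in a null set, so some outcome
    in it satisfies the orbit condition. This allows \<open>supp\<close> to be checked at a single
    outcome.\<close>
  have occurs: "\<exists>\<omega>\<in>space M. map (\<lambda>i. \<xi> i \<omega>) [1..<Suc n] = x \<and>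
      sum_dirac (alphabet k) n (\<lambda>j. \<xi> j \<omega>) \<in> relabel_orbit k (sum_dirac (alphabet k) n x0)"
    if "p x \<noteq> 0" for x
  proof (rule ccontr)
    assume no: "\<not> ?thesis"
    have "AE \<omega> in M. \<omega> \<notin> {\<omega> \<in> space M. map (\<lambda>i. \<xi> i \<omega>) [1..<Suc n] = x}"
      using orbit by eventually_elim (use no in auto)
    then have "p x = 0" unfolding p_def word_prob_def
      using word_event_sets[of n \<xi> M k, OF meas] by (subst prob_eq_0) auto
    with that show False by simp
  qed
  have supp: "set x \<subseteq> {1..k} \<and> (\<Sum>c\<in>{1..k}. (count (mset x) c)\<^sup>2) = C" and len: "length x = n"
    if nz: "p x \<noteq> 0" for x
  proof -
    obtain \<omega> where \<omega>: "\<omega> \<in> space M" and x: "x = map (\<lambda>i. \<xi> i \<omega>) [1..<Suc n]"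
      and orb: "sum_dirac (alphabet k) n (\<lambda>j. \<xi> j \<omega>) \<in> relabel_orbit k (sum_dirac (alphabet k) n x0)"
      using occurs[OF nz] by blast
    have "\<xi> j \<omega> \<in> {1..k}" if "j \<in> {1..n}" for j
      using measurable_space[OF meas[OF that] \<omega>] by (simp add: alphabet_def)
    then show "set x \<subseteq> {1..k} \<and> (\<Sum>c\<in>{1..k}. (count (mset x) c)\<^sup>2) = C"
      using sum_count_squares_relabel_orbit[OF x0 orb] unfolding x C_def by (auto simp del: upt_Suc)
    show "length x = n" by (simp add: x)
  qed
  have spread: "(\<Sum>c\<in>{1..k}. p (s @ c # t)) = (\<Sum>c\<in>{1..k}. p (s' @ c # t'))"
    if st: "s @ t = s' @ t'" for s t s' t'
  proof (cases "Suc (length s + length t) = n")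
    case True
    have l: "length s + length t = length s' + length t'" using st by (metis length_append)
    define j j' where "j = Suc (length s)" and "j' = Suc (length s')"
    have j: "j \<in> {1..n}" "j' \<in> {1..n}" using True l by (auto simp: j_def j'_def)
    then have eq: "joint_law M (alphabet k) (n - 1) (\<lambda>i. \<xi> (skip j i))
        = joint_law M (alphabet k) (n - 1) (\<lambda>i. \<xi> (skip j' i))"
      using assms(5) unfolding spreadable_def by blast
    have "\<xi> (skip l i) \<in> measurable M (alphabet k)" if "i \<in> {1..n - 1}" for i l
      using that by (intro meas) (auto simp: skip_def)
    then have "word_prob M (n - 1) (\<lambda>i. \<xi> (skip j i)) (s @ t)
        = word_prob M (n - 1) (\<lambda>i. \<xi> (skip j' i)) (s' @ t')"
      using eq st by (subst (1 2) word_prob_joint_law[where k = k]) auto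
    then show ?thesis
      using word_prob_skip[where X = \<xi> and s = s and t = t, OF assms(3) meas]
        word_prob_skip[where X = \<xi> and s = s' and t = t', OF assms(3) meas] True l[symmetric]
      by (auto simp: p_def j_def j'_def)
  next
    case False
    moreover have "length s + length t = length s' + length t'" using st by (metis length_append)
    \<comment> \<open>The words with a letter inserted do not have length \<open>n\<close>, so every
      term is 0.\<close>
    ultimately have "p (s @ c # t) = 0" "p (s' @ c # t') = 0" for c
      using len[of "s @ c # t"] len[of "s' @ c # t'"] by auto
    then show ?thesis by simp
  qed
  have sym: "p (map \<tau> x) = p x" if \<tau>: "\<tau> permutes {1..k}" for \<tau> x
  proof -
    have "\<tau> \<in> measurable (alphabet k) (alphabet k)"
      using permutes_in_image[OF \<tau>] unfolding alphabet_def by (simp add: Pi_iff)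
    then have "(\<lambda>\<omega>. \<tau> (\<xi> j \<omega>)) \<in> measurable M (alphabet k)" if "j \<in> {1..n}" for j
      using measurable_compose[OF meas[OF that]] by blast
    \<comment> \<open>Alphabet invariance replaces each variable by its image under
      \<open>\<tau>\<close>; injectivity then cancels \<open>\<tau>\<close> on both sides of the
      event.\<close>
    then have "p (map \<tau> x) = word_prob M n (\<lambda>i \<omega>. \<tau> (\<xi> i \<omega>)) (map \<tau> x)"
      using assms(6) \<tau> meas unfolding p_def alphabet_invariant_def
      by (subst (1 2) word_prob_joint_law[where k = k]) auto
    also have "\<dots> = p x"
    proof -
      have "map (\<lambda>i. \<tau> (\<xi> i \<omega>)) [1..<Suc n] = map \<tau> (map (\<lambda>i. \<xi> i \<omega>) [1..<Suc n])" for \<omega>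
        by (simp del: upt_Suc)
      then show ?thesis
        unfolding p_def word_prob_def using inj_map_eq_map[OF permutes_inj[OF \<tau>]] by metis
    qed
    finally show ?thesis .
  qed
  show ?thesis
    unfolding exchangeable_def
  proof (intro allI impI joint_law_eqI assms(3) meas)
    fix \<pi> j assume "\<pi> permutes {1..n}" "j \<in> {1..n}"
    then show "\<pi> j \<in> {1..n}" using permutes_in_image by metis
  next
    fix \<pi> f assume \<pi>: "\<pi> permutes {1..n}"
    have inv: "inv \<pi> permutes {1..n}" using \<pi> by (rule permutes_inv)
    \<comment> \<open>Substituting \<open>inv \<pi> i\<close> for \<open>i\<close> moves the
      permutation from the variables to the positions of the word.\<close>
    have "(\<forall>i\<in>{1..n}. \<xi> (\<pi> i) \<omega> = f i) \<longleftrightarrow> (\<forall>i\<in>{1..n}. \<xi> i \<omega> = f (inv \<pi> i))" for \<omega>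
      using permutes_in_image[OF \<pi>] permutes_in_image[OF inv] permutes_inverses[OF \<pi>] by metis
    then have "word_prob M n (\<lambda>i. \<xi> (\<pi> i)) (map f [1..<Suc n]) = p (map (\<lambda>i. f (inv \<pi> i)) [1..<Suc n])"
      unfolding word_prob_def p_def map_word_eq_iff by simp
    also have "\<dots> = p (map f [1..<Suc n])"
    proof (rule spread_law_permutation_invariant[where A = "{1..k}" and C = C, OF _ spread sym supp])
      have "mset (map (\<lambda>i. f (inv \<pi> i)) [1..<Suc n]) = image_mset f (image_mset (inv \<pi>) (mset_set {1..n}))"
        by (simp add: multiset.map_comp o_def mset_upt atLeastLessThanSuc_atLeastAtMost del: upt_Suc)
      also have "image_mset (inv \<pi>) (mset_set {1..n}) = mset_set {1..n}"
        using inv by (simp add: image_mset_mset_set permutes_inj_on permutes_image)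
      also have "image_mset f (mset_set {1..n}) = mset (map f [1..<Suc n])"
        by (simp add: mset_upt atLeastLessThanSuc_atLeastAtMost del: upt_Suc)
      finally show "mset (map (\<lambda>i. f (inv \<pi> i)) [1..<Suc n]) = mset (map f [1..<Suc n])" .
    qed simp_all
    finally show "word_prob M n (\<lambda>i. \<xi> (\<pi> i)) (map f [1..<Suc n]) = word_prob M n \<xi> (map f [1..<Suc n])"
      by (simp add: p_def)
  qed
qed

end
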